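(* A graph $G$ is $3$-$\chi_\rho$-critical if and only if $G$ is isomorphic to one of $C_3$, $P_4$, $C_4$.
   Context: Graphs are finite, simple and undirected, with nonempty vertex set. Distance is shortest-path distance ($\infty$ between different components). For a positive integer $i$, an $i$-packing in $G$ is a set of vertices such that any two distinct vertices in it are at distance greater than $i$. The packing chromatic number $\chi_\rho(G)$ is the smallest integer $k$ such that $V(G)$ can be partitioned into (possibly empty) sets $V_1,\ldots,V_k$ with $V_i$ an $i$-packing for each $i\in\{1,\ldots,k\}$. $G-x$ denotes the graph obtained from $G$ by deleting the vertex $x$. A graph $G$ is $k$-$\chi_\rho$-critical if $\chi_\rho(G)=k$ and $\chi_\rho(G-x)<k$ for every vertex $x$ of $G$. $C_n$ and $P_n$ denote the cycle and the path on $n$ vertices. *)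

theory Defs
  imports "Graph_Theory.Graph_Theory"
begin

text \<open>
  Finite simple undirected graphs are the symmetric loop-free digraphs without parallel arcs
  of the locale \<^locale>\<open>graph\<close>; every edge is represented by its two arcs. That locale admits
  the graph without vertices, so nonemptiness has to be assumed where it is wanted.
\<close>

text \<open>With unit arc costs, \<mu> is the length of a shortest walk, and \<infinity> if there is none.\<close>
definition graph_dist :: "('a, 'b) pre_digraph \<Rightarrow> 'a \<Rightarrow> 'a \<Rightarrow> ereal" where
  "graph_dist G u v = wf_digraph.\<mu> G (\<lambda>_. 1) u v"

definition i_packing :: "('a, 'b) pre_digraph \<Rightarrow> nat \<Rightarrow> 'a set \<Rightarrow> bool" where
  "i_packing G i S \<longleftrightarrow>
     S \<subseteq> verts G \<and> (\<forall>u\<in>S. \<forall>v\<in>S. u \<noteq> v \<longrightarrow> ereal (real i) < graph_dist G u v)"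

definition packing_colourable :: "('a, 'b) pre_digraph \<Rightarrow> nat \<Rightarrow> bool" where
  "packing_colourable G k \<longleftrightarrow>
     (\<exists>V :: nat \<Rightarrow> 'a set.
        (\<Union>i\<in>{1..k}. V i) = verts G \<and> disjoint_family_on V {1..k} \<and>
        (\<forall>i\<in>{1..k}. i_packing G i (V i)))"

text \<open>
  On a finite graph the minimum exists, since singletons are \<open>i\<close>-packings for every \<open>i\<close>.
  The graph without vertices, which arises by deleting the only vertex of a graph, gets the value 0.
\<close>
definition packing_chromatic_number :: "('a, 'b) pre_digraph \<Rightarrow> nat" where
  "packing_chromatic_number G = (LEAST k. packing_colourable G k)"

definition packing_critical :: "nat \<Rightarrow> ('a, 'b) pre_digraph \<Rightarrow> bool" where
  "packing_critical k G \<longleftrightarrow>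
     packing_chromatic_number G = k \<and>
     (\<forall>x\<in>verts G. packing_chromatic_number (pre_digraph.del_vert G x) < k)"

text \<open>\<open>path_graph n\<close> has \<open>n\<close> vertices (and \<open>n - 1\<close> edges).\<close>
definition path_graph :: "nat \<Rightarrow> (nat, nat \<times> nat) pre_digraph" where
  "path_graph n = with_proj
     \<lparr> pverts = {0..<n},
       parcs = {(u, v). u < n \<and> v < n \<and> (v = Suc u \<or> u = Suc v)} \<rparr>"

text \<open>Only meaningful for \<open>n \<ge> 3\<close>.\<close>
definition cycle_graph :: "nat \<Rightarrow> (nat, nat \<times> nat) pre_digraph" where
  "cycle_graph n = with_proj
     \<lparr> pverts = {0..<n},
       parcs = {(u, v). u < n \<and> v < n \<and> (v = Suc u mod n \<or> u = Suc v mod n)} \<rparr>"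

end

theory Submission
  imports Defs
begin

text \<open>
  Having packing chromatic number at most 2 is a local property: a graph has such a colouring if
  and only if it has no walk \<open>a b c d\<close> of length 3 that does not turn back, that is, with
  \<open>a \<noteq> c\<close> and \<open>b \<noteq> d\<close> (lemma \<open>packing_colourable_2_iff\<close>). Such a walk is a triangle if \<open>a = d\<close> and
  a path on four vertices, not necessarily induced, otherwise. If there is one, consecutive
  vertices cannot both have colour 1, and vertices at distance at most 2 cannot both have
  colour 2, which is contradictory along the walk. If there is none, the components are stars, and
  the centres of the stars can be given colour 2 and the remaining vertices colour 1.

  Deleting a vertex destroys exactly the walks through it. So \<open>G\<close> is critical for the value 3 if and
  only if it has such a walk and every such walk meets every vertex (lemma
  \<open>packing_critical_3_iff\<close>). The bound \<open>\<chi>\<^sub>\<rho> \<le> 3\<close> follows: with vertex set \<open>{a, b, c, d}\<close>, give \<open>b\<close> and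
  \<open>d\<close> the colours 2 and 3. This criterion speaks of adjacency only, so it is invariant
  under isomorphism and can be tested on the three given graphs. Conversely, if it holds then
  the graph has either three vertices and is a triangle, or four vertices and no triangle,
  and then the only freedom is whether the ends of the path \<open>a b c d\<close> are adjacent.
\<close>

section \<open>Short distances\<close>

lemma (in wf_digraph) less_graph_dist_iff:
  "ereal (real n) < graph_dist G u v \<longleftrightarrow> (\<forall>p. awalk u p v \<longrightarrow> n < length p)"
proof -
  have cost: "awalk_cost (\<lambda>_. 1) p = real (length p)" for p
    by (induct p) auto
  show ?thesis
  proof
    assume less: "ereal (real n) < graph_dist G u v"
    show "\<forall>p. awalk u p v \<longrightarrow> n < length p"
    proof (intro allI impI)
      fix p assume "awalk u p v"
      from less min_cost_le_walk_cost[OF this, of "\<lambda>_. 1"]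
      have "ereal (real n) < ereal (real (length p))"
        unfolding graph_dist_def cost by (rule less_le_trans)
      then show "n < length p" by simp
    qed
  next
    assume longer: "\<forall>p. awalk u p v \<longrightarrow> n < length p"
    \<comment> \<open>Lengths are integers, so the infimum stays away from \<open>n\<close>.\<close>
    have "ereal (real (Suc n)) \<le> graph_dist G u v"
      unfolding graph_dist_def \<mu>_def cost
    proof (rule INF_greatest)
      fix p assume "p \<in> {p. awalk u p v}"
      with longer have "Suc n \<le> length p" by auto
      then show "ereal (real (Suc n)) \<le> ereal (real (length p))"
        by (simp del: of_nat_Suc)
    qed
    moreover have "ereal (real n) < ereal (real (Suc n))" by simp
    ultimately show "ereal (real n) < graph_dist G u v" by (rule less_le_trans[rotated])
  qed
qed

lemma (in wf_digraph) graph_dist_gt_1_iff: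
  assumes "u \<in> verts G" "u \<noteq> v"
  shows "ereal (real 1) < graph_dist G u v \<longleftrightarrow> \<not> u \<rightarrow> v"
proof -
  have "(\<exists>p. awalk u p v \<and> length p \<le> 1) \<longleftrightarrow> u \<rightarrow> v"
  proof
    assume "\<exists>p. awalk u p v \<and> length p \<le> 1"
    then obtain p where "awalk u p v" "length p \<le> 1" by blast
    then show "u \<rightarrow> v" using assms
      by (cases p) (auto simp: awalk_simps arcs_ends_conv)
  next
    assume "u \<rightarrow> v"
    then obtain e where "e \<in> arcs G" "tail G e = u" "head G e = v" by auto
    then have "awalk u [e] v" by (auto simp: awalk_simps)
    then show "\<exists>p. awalk u p v \<and> length p \<le> 1" by (intro exI[of _ "[e]"]) simp
  qed
  then show ?thesis unfolding less_graph_dist_iff by (meson not_le)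
qed

lemma (in wf_digraph) graph_dist_gt_2_iff:
  assumes "u \<in> verts G" "u \<noteq> v"
  shows "ereal (real 2) < graph_dist G u v \<longleftrightarrow> \<not> u \<rightarrow> v \<and> (\<forall>w. \<not> (u \<rightarrow> w \<and> w \<rightarrow> v))"
proof -
  have "(\<exists>p. awalk u p v \<and> length p \<le> 2) \<longleftrightarrow> u \<rightarrow> v \<or> (\<exists>w. u \<rightarrow> w \<and> w \<rightarrow> v)"
  proof
    assume "\<exists>p. awalk u p v \<and> length p \<le> 2"
    then obtain p where p: "awalk u p v" "length p \<le> 2" by blast
    with assms obtain e q where q: "p = e # q" by (cases p) (auto simp: awalk_simps)
    show "u \<rightarrow> v \<or> (\<exists>w. u \<rightarrow> w \<and> w \<rightarrow> v)"
      using p q by (cases q) (auto simp: awalk_simps intro!: dominatesI simp: arc_to_ends_def)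
  next
    assume "u \<rightarrow> v \<or> (\<exists>w. u \<rightarrow> w \<and> w \<rightarrow> v)"
    then show "\<exists>p. awalk u p v \<and> length p \<le> 2"
    proof (elim disjE exE conjE)
      assume "u \<rightarrow> v"
      then obtain e where "e \<in> arcs G" "tail G e = u" "head G e = v" by auto
      then show ?thesis by (intro exI[of _ "[e]"]) (auto simp: awalk_simps)
    next
      fix w assume "u \<rightarrow> w" "w \<rightarrow> v"
      then obtain e f where "e \<in> arcs G" "tail G e = u" "head G e = w"
        "f \<in> arcs G" "tail G f = w" "head G f = v" by (metis reachableE)
      then show ?thesis by (intro exI[of _ "[e, f]"]) (auto simp: awalk_simps)
    qed
  qed
  then show ?thesis unfolding less_graph_dist_iff by (meson not_le)
qed

lemma (in wf_digraph) i_packing_1_iff: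
  assumes "S \<subseteq> verts G"
  shows "i_packing G 1 S \<longleftrightarrow> (\<forall>u\<in>S. \<forall>v\<in>S. u \<noteq> v \<longrightarrow> \<not> u \<rightarrow> v)"
  using assms graph_dist_gt_1_iff unfolding i_packing_def by (meson subsetD)

lemma (in wf_digraph) i_packing_2_iff:
  assumes "S \<subseteq> verts G"
  shows "i_packing G 2 S \<longleftrightarrow>
    (\<forall>u\<in>S. \<forall>v\<in>S. u \<noteq> v \<longrightarrow> \<not> u \<rightarrow> v \<and> (\<forall>w. \<not> (u \<rightarrow> w \<and> w \<rightarrow> v)))"
  using assms graph_dist_gt_2_iff unfolding i_packing_def by (meson subsetD)

section \<open>Packing colourings with few colours\<close>

lemma i_packing_empty: "i_packing G i {}"
  and i_packing_singleton: "v \<in> verts G \<Longrightarrow> i_packing G i {v}"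
  by (simp_all add: i_packing_def)

lemma packing_colourable_mono:
  assumes "packing_colourable G k" "k \<le> m"
  shows "packing_colourable G m"
proof -
  obtain V where V: "(\<Union>i\<in>{1..k}. V i) = verts G" "disjoint_family_on V {1..k}"
    "\<forall>i\<in>{1..k}. i_packing G i (V i)"
    using assms(1) by (auto simp: packing_colourable_def)
  let ?W = "\<lambda>i. if i \<le> k then V i else {}"
  have "{1..m} = {1..k} \<union> {k<..m}" using assms(2) by auto
  then have "(\<Union>i\<in>{1..m}. ?W i) = (\<Union>i\<in>{1..k}. V i)" by auto
  moreover have "disjoint_family_on ?W {1..m}"
    using V(2) by (auto simp: disjoint_family_on_def)
  moreover have "\<forall>i\<in>{1..m}. i_packing G i (?W i)"
    using V(3) by (simp add: i_packing_empty)
  ultimately show ?thesis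
    unfolding packing_colourable_def using V(1) by (intro exI[of _ ?W] conjI) simp_all
qed

lemma (in fin_digraph) packing_colourable_card: "packing_colourable G (card (verts G))"
proof -
  obtain f where f: "bij_betw f {1..card (verts G)} (verts G)"
    using finite_same_card_bij[of "{1..card (verts G)}" "verts G"] by auto
  have "(\<Union>i\<in>{1..card (verts G)}. {f i}) = verts G"
    using bij_betw_imp_surj_on[OF f] by blast
  moreover have "disjoint_family_on (\<lambda>i. {f i}) {1..card (verts G)}"
    using f by (auto simp: bij_betw_def disjoint_family_on_def dest: inj_onD)
  moreover have "\<forall>i\<in>{1..card (verts G)}. i_packing G i {f i}"
    using bij_betw_apply[OF f] by (blast intro: i_packing_singleton)
  ultimately show ?thesis unfolding packing_colourable_def by blast
qed

text \<open>The set of admissible numbers of colours is nonempty and upward closed.\<close>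
lemma (in fin_digraph) packing_chromatic_number_le_iff:
  "packing_chromatic_number G \<le> k \<longleftrightarrow> packing_colourable G k"
  using LeastI[of "packing_colourable G", OF packing_colourable_card]
    packing_colourable_mono Least_le[of "packing_colourable G" k]
  unfolding packing_chromatic_number_def by blast

lemma atLeastAtMost_1_2: "{1..2} = {1, 2::nat}"
  and atLeastAtMost_1_3: "{1..3} = {1, 2, 3::nat}"
  by auto

lemma packing_colourable_2_iff_ex:
  "packing_colourable G 2 \<longleftrightarrow>
    (\<exists>S\<subseteq>verts G. i_packing G 1 (verts G - S) \<and> i_packing G 2 S)" (is "?L \<longleftrightarrow> ?R")
proof
  assume ?L
  then obtain V where V: "V 1 \<union> V 2 = verts G" "V 1 \<inter> V 2 = {}"
      "i_packing G 1 (V 1)" "i_packing G 2 (V (2::nat))"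
    unfolding packing_colourable_def atLeastAtMost_1_2 disjoint_family_on_def by auto
  then have "V 1 = verts G - V 2" by blast
  with V show ?R by (metis Un_upper2)
next
  assume ?R
  then obtain S where S: "S \<subseteq> verts G" "i_packing G 1 (verts G - S)" "i_packing G 2 S" by blast
  then show ?L
    unfolding packing_colourable_def atLeastAtMost_1_2 disjoint_family_on_def
    by (intro exI[of _ "\<lambda>i. if i = 1 then verts G - S else S"]) auto
qed

lemma packing_colourable_3I:
  assumes "b \<in> verts G" "d \<in> verts G" "b \<noteq> d" "i_packing G 1 (verts G - {b, d})"
  shows "packing_colourable G 3"
  using assms unfolding packing_colourable_def atLeastAtMost_1_3 disjoint_family_on_def
  by (intro exI[of _ "\<lambda>i. if i = 1 then verts G - {b, d} else if i = 2 then {b} else {d}"])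
    (auto simp: i_packing_singleton)

section \<open>Two colours and walks of length 3\<close>

text \<open>
  A non-backtracking walk of length 3. In a symmetric loop-free relation the only vertices that can
  coincide are \<open>a\<close> and \<open>d\<close>, so it traverses a path on four vertices or a triangle.
\<close>
definition nonbacktracking :: "('a \<times> 'a) set \<Rightarrow> 'a \<Rightarrow> 'a \<Rightarrow> 'a \<Rightarrow> 'a \<Rightarrow> bool" where
  "nonbacktracking R a b c d \<longleftrightarrow>
     (a, b) \<in> R \<and> (b, c) \<in> R \<and> (c, d) \<in> R \<and> a \<noteq> c \<and> b \<noteq> d"

context graph
begin

lemma adj_sym: "u \<rightarrow> v \<Longrightarrow> v \<rightarrow> u"
  using arcs_ends_symmetric[OF sym_arcs] .

lemma adj_neq: "u \<rightarrow> v \<Longrightarrow> u \<noteq> v"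
  using adj_not_same by blast

text \<open>
  One of \<open>a\<close>, \<open>b\<close> has colour 2. The next two vertices of the walk are distinct from it and within
  distance 2 of it, so these two adjacent vertices both have colour 1.
\<close>
lemma nonbacktracking_not_2_colourable:
  assumes walk: "nonbacktracking (arcs_ends G) a b c d"
  shows "\<not> packing_colourable G 2"
proof
  assume "packing_colourable G 2"
  then obtain S where S: "S \<subseteq> verts G" "i_packing G 1 (verts G - S)" "i_packing G 2 S"
    by (auto simp: packing_colourable_2_iff_ex)
  have cover: "u \<in> S \<or> v \<in> S" if "u \<rightarrow> v" for u v
    using S(2) that adj_neq[OF that] adj_in_verts[OF that]
    unfolding i_packing_1_iff[OF Diff_subset] by blast
  have sep1: "\<not> (u \<in> S \<and> v \<in> S)" if "u \<rightarrow> v" for u v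
    using S(1,3) that adj_neq[OF that] by (auto simp: i_packing_2_iff)
  have sep2: "\<not> (u \<in> S \<and> v \<in> S)" if "u \<rightarrow> w" "w \<rightarrow> v" "u \<noteq> v" for u v w
    using S(1,3) that by (auto simp: i_packing_2_iff)
  show False
    using walk cover sep1 sep2 unfolding nonbacktracking_def by metis
qed

text \<open>
  Without such walks every component is a star. Colour 2 goes to the vertices of degree at least 2
  and, since in a component with a single edge both ends qualify as its centre, to one end of each
  such edge.
\<close>
lemma no_nonbacktracking_2_colourable:
  assumes none: "\<And>a b c d. \<not> nonbacktracking (arcs_ends G) a b c d"
  shows "packing_colourable G 2"
proof -
  define branching where "branching v \<longleftrightarrow> (\<exists>x y. x \<noteq> y \<and> v \<rightarrow> x \<and> v \<rightarrow> y)" for v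
  define leaf_of where "leaf_of v u \<longleftrightarrow> (\<forall>w. v \<rightarrow> w \<longleftrightarrow> w = u)" for v u
  \<comment> \<open>As a function of the unordered pair, \<open>pick\<close> makes the same choice seen from either end.\<close>
  define pick where "pick A = (SOME w. w \<in> A)" for A :: "'a set"
  define chosen where
    "chosen v \<longleftrightarrow> (\<exists>u. leaf_of v u \<and> leaf_of u v \<and> v = pick {u, v})" for v
  define S where "S = {v \<in> verts G. branching v \<or> chosen v}"
  have other: "\<exists>x. v \<rightarrow> x \<and> x \<noteq> w" if "branching v" for v w
    using that by (auto simp: branching_def)
  have leaf: "leaf_of v u" if "v \<rightarrow> u" "\<not> branching v" for u v
    using that by (auto simp: branching_def leaf_of_def)
  have no_branching_edge: "\<not> (branching u \<and> branching v)" if "u \<rightarrow> v" for u v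
  proof
    assume "branching u \<and> branching v"
    then obtain x y where "u \<rightarrow> x" "x \<noteq> v" "v \<rightarrow> y" "y \<noteq> u" using other by meson
    with that none[of x u v y] show False by (auto simp: nonbacktracking_def intro: adj_sym)
  qed
  have chosen_nbr: "leaf_of u v" if "chosen v" "v \<rightarrow> u" for u v
    using that by (auto simp: chosen_def leaf_of_def)
  have leaf_not_branching: "\<not> branching v" if "leaf_of v u" for u v
    using that by (auto simp: branching_def leaf_of_def)
  have not_both: "\<not> (u \<in> S \<and> v \<in> S)" if uv: "u \<rightarrow> v" for u v
  proof
    assume inS: "u \<in> S \<and> v \<in> S"
    have vu: "v \<rightarrow> u" using uv by (rule adj_sym)
    have "chosen u \<and> chosen v"
      using inS no_branching_edge[OF uv] chosen_nbr[OF _ uv] chosen_nbr[OF _ vu]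
        leaf_not_branching by (auto simp: S_def)
    then have "u = pick {v, u}" "v = pick {u, v}"
      using uv vu unfolding chosen_def leaf_of_def by metis+
    then have "u = v" by (simp add: insert_commute)
    with adj_neq[OF uv] show False ..
  qed
  have not_common: "\<not> (u \<in> S \<and> v \<in> S)" if uw: "u \<rightarrow> w" and wv: "w \<rightarrow> v" and "u \<noteq> v" for u v w
  proof
    assume inS: "u \<in> S \<and> v \<in> S"
    have "branching w" using wv adj_sym[OF uw] \<open>u \<noteq> v\<close> by (auto simp: branching_def)
    then have "\<not> chosen u" using chosen_nbr[OF _ uw] leaf_not_branching by blast
    then have "branching u" using inS by (simp add: S_def)
    then obtain x where "u \<rightarrow> x" "x \<noteq> w" using other by meson
    with none[of x u w v] uw wv \<open>u \<noteq> v\<close> show False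
      by (auto simp: nonbacktracking_def intro: adj_sym)
  qed
  have cover: "u \<in> S \<or> v \<in> S" if uv: "u \<rightarrow> v" for u v
  proof (rule ccontr)
    assume neither: "\<not> (u \<in> S \<or> v \<in> S)"
    have vu: "v \<rightarrow> u" using uv by (rule adj_sym)
    have "leaf_of u v" "leaf_of v u"
      using neither leaf[OF uv] leaf[OF vu] adj_in_verts[OF uv] by (auto simp: S_def)
    moreover have "pick {u, v} \<in> {u, v}" unfolding pick_def by (rule someI[of _ u]) simp
    then have "u = pick {v, u} \<or> v = pick {u, v}" by (auto simp: insert_commute)
    ultimately have "chosen u \<or> chosen v" unfolding chosen_def by blast
    then show False using neither adj_in_verts[OF uv] by (auto simp: S_def)
  qed
  have "S \<subseteq> verts G" by (auto simp: S_def)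
  moreover have "i_packing G 1 (verts G - S)"
    using cover unfolding i_packing_1_iff[OF Diff_subset] by blast
  moreover have "i_packing G 2 S"
    using \<open>S \<subseteq> verts G\<close> not_both not_common by (subst i_packing_2_iff) blast+
  ultimately show ?thesis unfolding packing_colourable_2_iff_ex by blast
qed

lemma packing_colourable_2_iff:
  "packing_colourable G 2 \<longleftrightarrow> \<not> (\<exists>a b c d. nonbacktracking (arcs_ends G) a b c d)"
  using nonbacktracking_not_2_colourable no_nonbacktracking_2_colourable by blast

end

section \<open>Criticality in terms of adjacency\<close>

lemma arcs_ends_del_vert:
  "arcs_ends (pre_digraph.del_vert G x) = {(u, v) \<in> arcs_ends G. u \<noteq> x \<and> v \<noteq> x}"
  by (auto simp: arcs_ends_conv pre_digraph.del_vert_simps)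

lemma (in graph) graph_del_vert: "graph (del_vert x)"
proof -
  interpret D: fin_digraph "del_vert x" by (rule fin_digraph_del_vert)
  interpret D: digraph "del_vert x"
    by unfold_locales (auto simp: del_vert_simps ends_del_vert no_loops no_multi_arcs)
  show ?thesis
    using sym_arcs by (intro D.graphI) (auto simp: symmetric_def arcs_ends_del_vert sym_def)
qed

text \<open>
  Criticality expressed through \<open>nonbacktracking\<close>: the second part says that deleting any vertex
  destroys all such walks.
\<close>
definition spanned_by_nonbacktracking :: "'a set \<Rightarrow> ('a \<times> 'a) set \<Rightarrow> bool" where
  "spanned_by_nonbacktracking V R \<longleftrightarrow>
     (\<exists>a b c d. nonbacktracking R a b c d) \<and>
     (\<forall>a b c d. nonbacktracking R a b c d \<longrightarrow> V \<subseteq> {a, b, c, d})"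

context graph
begin

text \<open>
  Colour \<open>b\<close> and \<open>d\<close> with 2 and 3. The vertices \<open>a\<close> and \<open>c\<close> then receive colour 1 unless \<open>a = d\<close>; an
  edge between them would close a triangle that misses \<open>d\<close>.
\<close>
lemma spanned_3_colourable:
  assumes spanned: "spanned_by_nonbacktracking (verts G) (arcs_ends G)"
  shows "packing_colourable G 3"
proof -
  obtain a b c d where walk: "nonbacktracking (arcs_ends G) a b c d"
    using spanned by (auto simp: spanned_by_nonbacktracking_def)
  then have V: "verts G \<subseteq> {a, b, c, d}"
    using spanned by (auto simp: spanned_by_nonbacktracking_def)
  have adj: "a \<rightarrow> b" "b \<rightarrow> c" "c \<rightarrow> d" and neq: "a \<noteq> c" "b \<noteq> d"
    using walk by (auto simp: nonbacktracking_def)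
  have in_V: "b \<in> verts G" "d \<in> verts G" using adj adj_in_verts by blast+
  have no_ac: "\<not> a \<rightarrow> c" if "a \<noteq> d"
  proof
    assume "a \<rightarrow> c"
    then have "nonbacktracking (arcs_ends G) a b c a"
      using adj neq adj_neq[of a b] by (auto simp: nonbacktracking_def intro: adj_sym)
    then have "verts G \<subseteq> {a, b, c, a}"
      using spanned unfolding spanned_by_nonbacktracking_def by blast
    with in_V(2) that neq adj_neq[OF adj(3)] show False by auto
  qed
  then have no_ca: "\<not> c \<rightarrow> a" if "a \<noteq> d" using that adj_sym by blast
  have "i_packing G 1 (verts G - {b, d})"
    using V no_ac no_ca by (subst i_packing_1_iff) blast+
  then show ?thesis using in_V neq(2) by (intro packing_colourable_3I[of b G d])
qed

lemma packing_critical_3_iff: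
  "packing_critical 3 G \<longleftrightarrow> spanned_by_nonbacktracking (verts G) (arcs_ends G)"
proof -
  have del: "packing_chromatic_number (del_vert x) < 3 \<longleftrightarrow>
      (\<forall>a b c d. nonbacktracking (arcs_ends G) a b c d \<longrightarrow> x \<in> {a, b, c, d})" for x
  proof -
    interpret D: graph "del_vert x" by (rule graph_del_vert)
    have "packing_chromatic_number (del_vert x) < 3 \<longleftrightarrow> packing_colourable (del_vert x) 2"
      using D.packing_chromatic_number_le_iff[of 2] by linarith
    also have "\<dots> \<longleftrightarrow>
        \<not> (\<exists>a b c d. nonbacktracking (arcs_ends G) a b c d \<and> x \<notin> {a, b, c, d})"
      by (auto simp: D.packing_colourable_2_iff nonbacktracking_def arcs_ends_del_vert)
    finally show ?thesis by blast
  qed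
  have "packing_chromatic_number G = 3 \<longleftrightarrow> packing_colourable G 3 \<and> \<not> packing_colourable G 2"
    using packing_chromatic_number_le_iff[of 2] packing_chromatic_number_le_iff[of 3] by linarith
  then show ?thesis
    unfolding packing_critical_def del packing_colourable_2_iff
    using spanned_3_colourable unfolding spanned_by_nonbacktracking_def by blast
qed

end

section \<open>Isomorphism with the three graphs\<close>

text \<open>
  Without parallel arcs an isomorphism is determined by its action on the vertices. The target has
  pairs as arcs, with the projections as end maps.
\<close>
lemma (in nomulti_digraph) digraph_iso_with_proj_iff:
  "digraph_iso G (with_proj P) \<longleftrightarrow>
    (\<exists>h. bij_betw h (verts G) (pverts P) \<and> parcs P = map_prod h h ` arcs_ends G)"
proof
  assume "digraph_iso G (with_proj P)"
  then obtain f where f: "digraph_isomorphism f" and P: "with_proj P = app_iso f G"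
    by (auto simp: digraph_iso_def)
  have "pverts P = iso_verts f ` verts G"
    using arg_cong[OF P, of verts] by simp
  moreover have "parcs P = map_prod (iso_verts f) (iso_verts f) ` arcs_ends G"
  proof -
    have "iso_tail f = fst" "iso_head f = snd"
      using arg_cong[OF P, of tail] arg_cong[OF P, of head] by simp_all
    then have "iso_arcs f e = map_prod (iso_verts f) (iso_verts f) (arc_to_ends G e)"
      if "e \<in> arcs G" for e
      using iso_verts_tail[OF f that] iso_verts_head[OF f that]
      by (auto simp: arc_to_ends_def prod_eq_iff)
    moreover have "parcs P = iso_arcs f ` arcs G"
      using arg_cong[OF P, of arcs] by simp
    ultimately show ?thesis by (auto simp: arcs_ends_def image_image)
  qed
  ultimately show "\<exists>h. bij_betw h (verts G) (pverts P) \<and> parcs P = map_prod h h ` arcs_ends G"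
    using digraph_isomorphism_inj_on_verts[OF f] by (auto simp: bij_betw_def)
next
  assume "\<exists>h. bij_betw h (verts G) (pverts P) \<and> parcs P = map_prod h h ` arcs_ends G"
  then obtain h where h: "inj_on h (verts G)" "h ` verts G = pverts P"
    and P: "parcs P = map_prod h h ` arcs_ends G" by (auto simp: bij_betw_def)
  let ?f = "\<lparr> iso_verts = h, iso_arcs = \<lambda>e. (h (tail G e), h (head G e)),
    iso_head = snd, iso_tail = fst \<rparr>"
  have "inj_on (iso_arcs ?f) (arcs G)"
    using h(1) by (auto intro!: inj_onI no_multi_arcs simp: arc_to_ends_def inj_on_eq_iff)
  then have "digraph_isomorphism ?f"
    using h(1) wf_digraph by (auto simp: digraph_isomorphism_def)
  moreover have "with_proj P = app_iso ?f G"
    using h(2) P by (auto simp: with_proj_def app_iso_def arcs_ends_conv image_image)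
  ultimately show "digraph_iso G (with_proj P)" unfolding digraph_iso_def by blast
qed

lemma spanned_by_nonbacktracking_image:
  assumes inj: "inj_on h V" and R: "R \<subseteq> V \<times> V"
    and spanned: "spanned_by_nonbacktracking (h ` V) (map_prod h h ` R)"
  shows "spanned_by_nonbacktracking V R"
proof -
  have walk: "nonbacktracking (map_prod h h ` R) (h a) (h b) (h c) (h d) \<longleftrightarrow>
      nonbacktracking R a b c d" if "a \<in> V" "b \<in> V" "c \<in> V" "d \<in> V" for a b c d
  proof -
    have "(h u, h v) \<in> map_prod h h ` R \<longleftrightarrow> (u, v) \<in> R" if "u \<in> V" "v \<in> V" for u v
    proof
      assume "(h u, h v) \<in> map_prod h h ` R"
      then obtain x y where xy: "(x, y) \<in> R" "h u = h x" "h v = h y" by auto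
      then have "u = x" "v = y" using that R inj by (auto dest: inj_onD)
      with xy(1) show "(u, v) \<in> R" by simp
    qed (rule map_prod_imageI)
    then show ?thesis using that inj_on_eq_iff[OF inj] by (simp add: nonbacktracking_def)
  qed
  have "\<exists>a b c d. nonbacktracking R a b c d"
  proof -
    obtain a' b' c' d' where w: "nonbacktracking (map_prod h h ` R) a' b' c' d'"
      using spanned by (auto simp: spanned_by_nonbacktracking_def)
    have "a' \<in> h ` V" "b' \<in> h ` V" "c' \<in> h ` V" "d' \<in> h ` V"
      using w R by (auto simp: nonbacktracking_def)
    then show ?thesis using w walk by blast
  qed
  moreover have "V \<subseteq> {a, b, c, d}" if w: "nonbacktracking R a b c d" for a b c d
  proof
    fix x assume "x \<in> V"
    have in_V: "a \<in> V" "b \<in> V" "c \<in> V" "d \<in> V"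
      using w R by (auto simp: nonbacktracking_def)
    then have "h ` V \<subseteq> {h a, h b, h c, h d}"
      using w walk spanned unfolding spanned_by_nonbacktracking_def by blast
    with \<open>x \<in> V\<close> have "h x \<in> {h a, h b, h c, h d}" by blast
    with \<open>x \<in> V\<close> in_V inj show "x \<in> {a, b, c, d}" by (auto simp: inj_on_eq_iff)
  qed
  ultimately show ?thesis unfolding spanned_by_nonbacktracking_def by blast
qed

lemma (in graph) digraph_iso_spanned:
  assumes iso: "digraph_iso G (with_proj P)"
    and spanned: "spanned_by_nonbacktracking (pverts P) (parcs P)"
  shows "spanned_by_nonbacktracking (verts G) (arcs_ends G)"
proof -
  obtain h where "inj_on h (verts G)" "pverts P = h ` verts G"
    "parcs P = map_prod h h ` arcs_ends G"
    using iso by (auto simp: digraph_iso_with_proj_iff bij_betw_def)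
  moreover have "arcs_ends G \<subseteq> verts G \<times> verts G" using adj_in_verts by auto
  ultimately show ?thesis using spanned by (auto intro: spanned_by_nonbacktracking_image)
qed

lemma less_3_iff: "(u::nat) < 3 \<longleftrightarrow> u = 0 \<or> u = 1 \<or> u = 2"
  and less_4_iff: "(u::nat) < 4 \<longleftrightarrow> u = 0 \<or> u = 1 \<or> u = 2 \<or> u = 3"
  by auto

lemma cycle_graph_3_explicit:
  "cycle_graph 3 = with_proj \<lparr> pverts = {0, 1, 2},
     parcs = {(0, 1), (1, 0), (1, 2), (2, 1), (2, 0), (0, 2)} \<rparr>"
  unfolding cycle_graph_def
  by (rule arg_cong[of _ _ with_proj]) (auto simp: less_3_iff)

lemma path_graph_4_explicit:
  "path_graph 4 = with_proj \<lparr> pverts = {0, 1, 2, 3},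
     parcs = {(0, 1), (1, 0), (1, 2), (2, 1), (2, 3), (3, 2)} \<rparr>"
  unfolding path_graph_def
  by (rule arg_cong[of _ _ with_proj]) (auto simp: less_4_iff)

lemma cycle_graph_4_explicit:
  "cycle_graph 4 = with_proj \<lparr> pverts = {0, 1, 2, 3},
     parcs = {(0, 1), (1, 0), (1, 2), (2, 1), (2, 3), (3, 2), (3, 0), (0, 3)} \<rparr>"
  unfolding cycle_graph_def
  by (rule arg_cong[of _ _ with_proj]) (auto simp: less_4_iff)

lemma spanned_triangle:
  "spanned_by_nonbacktracking {0, 1, 2 :: nat}
     {(0, 1), (1, 0), (1, 2), (2, 1), (2, 0), (0, 2)}" (is "spanned_by_nonbacktracking _ ?R")
proof -
  have "nonbacktracking ?R 0 1 2 0" by (simp add: nonbacktracking_def)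
  moreover have "{0, 1, 2} \<subseteq> {a, b, c, d}" if "nonbacktracking ?R a b c d" for a b c d
    using that by (auto simp: nonbacktracking_def)
  ultimately show ?thesis unfolding spanned_by_nonbacktracking_def by blast
qed

lemma spanned_path:
  "spanned_by_nonbacktracking {0, 1, 2, 3 :: nat}
     {(0, 1), (1, 0), (1, 2), (2, 1), (2, 3), (3, 2)}" (is "spanned_by_nonbacktracking _ ?R")
proof -
  have "nonbacktracking ?R 0 1 2 3" by (simp add: nonbacktracking_def)
  moreover have "{0, 1, 2, 3} \<subseteq> {a, b, c, d}" if "nonbacktracking ?R a b c d" for a b c d
    using that by (auto simp: nonbacktracking_def)
  ultimately show ?thesis unfolding spanned_by_nonbacktracking_def by blast
qed

lemma spanned_square:
  "spanned_by_nonbacktracking {0, 1, 2, 3 :: nat}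
     {(0, 1), (1, 0), (1, 2), (2, 1), (2, 3), (3, 2), (3, 0), (0, 3)}"
  (is "spanned_by_nonbacktracking _ ?R")
proof -
  have "nonbacktracking ?R 0 1 2 3" by (simp add: nonbacktracking_def)
  moreover have "{0, 1, 2, 3} \<subseteq> {a, b, c, d}" if "nonbacktracking ?R a b c d" for a b c d
    using that by (auto simp: nonbacktracking_def)
  ultimately show ?thesis unfolding spanned_by_nonbacktracking_def by blast
qed

lemma (in graph) spanned_imp_iso:
  assumes spanned: "spanned_by_nonbacktracking (verts G) (arcs_ends G)"
  shows "digraph_iso G (cycle_graph 3) \<or> digraph_iso G (path_graph 4) \<or>
    digraph_iso G (cycle_graph 4)"
proof -
  have cover: "verts G = {a, b, c, d}" if "nonbacktracking (arcs_ends G) a b c d" for a b c d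
    using that spanned adj_in_verts
    unfolding spanned_by_nonbacktracking_def nonbacktracking_def by blast
  have ends: "arcs_ends G \<subseteq> {(u, v). u \<in> verts G \<and> v \<in> verts G \<and> u \<noteq> v}"
    using adj_in_verts adj_not_same by auto
  show ?thesis
  proof (cases "\<exists>a b c. nonbacktracking (arcs_ends G) a b c a")
    case True
    then obtain a b c where walk: "nonbacktracking (arcs_ends G) a b c a" by blast
    then have V: "verts G = {a, b, c}" using cover by fastforce
    have adj: "a \<rightarrow> b" "b \<rightarrow> c" "c \<rightarrow> a" using walk by (auto simp: nonbacktracking_def)
    then have neq: "a \<noteq> b" "b \<noteq> c" "c \<noteq> a" using adj_neq by blast+
    have rev: "b \<rightarrow> a" "c \<rightarrow> b" "a \<rightarrow> c" using adj adj_sym by blast+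
    have A: "arcs_ends G = {(a, b), (b, a), (b, c), (c, b), (c, a), (a, c)}" (is "_ = ?A")
    proof (intro equalityI subrelI)
      fix u v assume uv: "u \<rightarrow> v"
      then have "u \<in> verts G" "v \<in> verts G" "u \<noteq> v" using ends by auto
      with uv show "(u, v) \<in> ?A" unfolding V by auto
    qed (use adj rev in auto)
    let ?h = "\<lambda>v. if v = a then 0 else if v = b then 1 else 2 :: nat"
    have "digraph_iso G (cycle_graph 3)"
      unfolding cycle_graph_3_explicit digraph_iso_with_proj_iff V A
      using neq by (intro exI[of _ ?h]) (auto simp: bij_betw_def inj_on_def)
    then show ?thesis ..
  next
    case False
    then have no_triangle: "\<not> nonbacktracking (arcs_ends G) a b c a" for a b c by blast
    obtain a b c d where walk: "nonbacktracking (arcs_ends G) a b c d"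
      using spanned by (auto simp: spanned_by_nonbacktracking_def)
    then have V: "verts G = {a, b, c, d}" by (rule cover)
    have adj: "a \<rightarrow> b" "b \<rightarrow> c" "c \<rightarrow> d" using walk by (auto simp: nonbacktracking_def)
    then have rev: "b \<rightarrow> a" "c \<rightarrow> b" "d \<rightarrow> c" using adj_sym by blast+
    have "a \<noteq> d" using walk no_triangle by blast
    then have neq: "a \<noteq> b" "a \<noteq> c" "a \<noteq> d" "b \<noteq> c" "b \<noteq> d" "c \<noteq> d"
      using walk adj adj_neq by (auto simp: nonbacktracking_def)
    have no_chord: "\<not> c \<rightarrow> a" "\<not> d \<rightarrow> b"
      using no_triangle[of a b c] no_triangle[of b c d] adj neq
      by (auto simp: nonbacktracking_def)
    then have no_chord': "\<not> a \<rightarrow> c" "\<not> b \<rightarrow> d" using adj_sym by blast+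
    let ?h = "\<lambda>v. if v = a then 0 else if v = b then 1 else if v = c then 2 else 3 :: nat"
    show ?thesis
    proof (cases "d \<rightarrow> a")
      case True
      then have ad: "a \<rightarrow> d" by (rule adj_sym)
      have A: "arcs_ends G =
          {(a, b), (b, a), (b, c), (c, b), (c, d), (d, c), (d, a), (a, d)}" (is "_ = ?A")
      proof (intro equalityI subrelI)
        fix u v assume uv: "u \<rightarrow> v"
        then have "u \<in> verts G" "v \<in> verts G" "u \<noteq> v" using ends by auto
        with uv show "(u, v) \<in> ?A" using no_chord no_chord' unfolding V by auto
      qed (use True ad adj rev in auto)
      have "digraph_iso G (cycle_graph 4)"
        unfolding cycle_graph_4_explicit digraph_iso_with_proj_iff V A
        using neq by (intro exI[of _ ?h]) (auto simp: bij_betw_def inj_on_def)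
      then show ?thesis by blast
    next
      case False
      then have not_ad: "\<not> a \<rightarrow> d" using adj_sym by blast
      have A: "arcs_ends G = {(a, b), (b, a), (b, c), (c, b), (c, d), (d, c)}" (is "_ = ?A")
      proof (intro equalityI subrelI)
        fix u v assume uv: "u \<rightarrow> v"
        then have "u \<in> verts G" "v \<in> verts G" "u \<noteq> v" using ends by auto
        with uv show "(u, v) \<in> ?A"
          using False not_ad no_chord no_chord' unfolding V by auto
      qed (use adj rev in auto)
      have "digraph_iso G (path_graph 4)"
        unfolding path_graph_4_explicit digraph_iso_with_proj_iff V A
        using neq by (intro exI[of _ ?h]) (auto simp: bij_betw_def inj_on_def)
      then show ?thesis by blast
    qed
  qed
qed

theorem proposition4p1:
  fixes G :: "('a, 'b) pre_digraph"
  assumes "graph G" and "verts G \<noteq> {}"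
  shows "packing_critical 3 G \<longleftrightarrow>
    digraph_iso G (cycle_graph 3) \<or> digraph_iso G (path_graph 4) \<or> digraph_iso G (cycle_graph 4)"
proof -
  interpret graph G by fact
  have "spanned_by_nonbacktracking (verts G) (arcs_ends G)"
    if "digraph_iso G (cycle_graph 3) \<or> digraph_iso G (path_graph 4) \<or>
      digraph_iso G (cycle_graph 4)"
    using that unfolding cycle_graph_3_explicit path_graph_4_explicit cycle_graph_4_explicit
    by (elim disjE; elim digraph_iso_spanned)
      (simp_all only: pair_pre_digraph.simps spanned_triangle spanned_path spanned_square)
  then show ?thesis unfolding packing_critical_3_iff using spanned_imp_iso by blast
qed

end
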